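(* For every integer $d\geq 1$, every positive integer $n$, and every nontrivial $(d-1)$-cycle $Z$ over $\mathbb{F}_2$ on $[n]$, there exists a collapsible $d$-forest $F$ on $[n]$ such that $\partial F = Z$ and $\binom{n-1}{d} - |F| \leq \binom{n-1}{d-2}$. Moreover, there are at least $n-2d$ different such $F$.
   Context: All chains are over $\mathbb{F}_2$ and identified with their supports (sets of simplices); addition is symmetric difference. A $k$-simplex is a $(k+1)$-element subset of $[n]$. The boundary $\partial X$ of a set $X$ of $k$-simplices is the set of $(k-1)$-simplices contained in an odd number of members of $X$. A set $Z$ of $k$-simplices is a $k$-cycle if $\partial Z=\emptyset$; nontrivial means nonempty. A set $F$ of $d$-simplices is a $d$-forest if no nonempty subset of $F$ is a $d$-cycle. Convention: $\binom{n}{k}=0$ for $k<0$. Collapsibility: in the simplicial complex generated by (the subset-closure of) a set $F$ of $d$-simplices, a $(d-1)$-face $\tau$ is exposed if it lies in exactly one $d$-face $\sigma$; an elementary collapse removes $\sigma$ and $\tau$; $F$ is collapsible if all its $d$-faces can be removed by a sequence of elementary collapses. *)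

theory Defs
  imports Main
begin

text \<open>
  Dimensions are integers, so that the empty set is the unique simplex of dimension -1.
  In particular a 0-cycle is a set of vertices of even cardinality (reduced homology).
\<close>

definition simplices :: "nat \<Rightarrow> int \<Rightarrow> nat set set" where
  "simplices n k = {\<sigma>. \<sigma> \<subseteq> {1..n} \<and> int (card \<sigma>) = k + 1}"

definition boundary :: "nat \<Rightarrow> int \<Rightarrow> nat set set \<Rightarrow> nat set set" where
  "boundary n k X = {\<tau> \<in> simplices n (k - 1). odd (card {\<sigma> \<in> X. \<tau> \<subseteq> \<sigma>})}"

definition is_cycle :: "nat \<Rightarrow> int \<Rightarrow> nat set set \<Rightarrow> bool" where
  "is_cycle n k Z \<longleftrightarrow> Z \<subseteq> simplices n k \<and> boundary n k Z = {}"

definition is_forest :: "nat \<Rightarrow> int \<Rightarrow> nat set set \<Rightarrow> bool" where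
  "is_forest n d F \<longleftrightarrow>
     F \<subseteq> simplices n d \<and> \<not> (\<exists>X. X \<subseteq> F \<and> X \<noteq> {} \<and> is_cycle n d X)"

definition generated_complex :: "nat set set \<Rightarrow> nat set set" where
  "generated_complex F = {\<tau>. \<exists>\<sigma>\<in>F. \<tau> \<subseteq> \<sigma>}"

definition elementary_collapse ::
    "nat \<Rightarrow> int \<Rightarrow> nat set set \<Rightarrow> nat set set \<Rightarrow> bool" where
  "elementary_collapse n d K K' \<longleftrightarrow>
     (\<exists>\<sigma> \<tau>. \<tau> \<in> K \<inter> simplices n (d - 1) \<and>
            {\<rho> \<in> K \<inter> simplices n d. \<tau> \<subseteq> \<rho>} = {\<sigma>} \<and>
            K' = K - {\<sigma>, \<tau>})"

definition collapsible :: "nat \<Rightarrow> int \<Rightarrow> nat set set \<Rightarrow> bool" where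
  "collapsible n d F \<longleftrightarrow>
     (\<exists>K. (elementary_collapse n d)\<^sup>*\<^sup>* (generated_complex F) K \<and> K \<inter> simplices n d = {})"

definition binom :: "nat \<Rightarrow> int \<Rightarrow> nat" where
  "binom m k = (if k < 0 then 0 else m choose nat k)"

end

theory Submission
  imports Defs Complex_Main
begin

text \<open>
  Induction on the number of vertices. Choose a vertex \<open>v\<close> of \<open>Z\<close>, let \<open>L\<close> be the link of \<open>v\<close> in \<open>Z\<close>
  and \<open>Z'\<close> the part of \<open>Z\<close> avoiding \<open>v\<close>. If \<open>A\<close> fills \<open>L\<close> and \<open>B\<close> fills \<open>A + Z'\<close>, both without
  using \<open>v\<close>, then \<open>v * A \<union> B\<close> fills \<open>Z\<close>; it collapses by first imitating the collapse of \<open>A\<close> and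
  then that of \<open>B\<close>, and the two size bounds add up by Pascal's rule. The induction hypothesis for
  \<open>B\<close> needs \<open>A \<noteq> Z'\<close>. For \<open>n > 2 * d\<close> this excludes only one of at least \<open>n - 2 * d + 1\<close> choices
  of \<open>A\<close>; for \<open>n \<le> 2 * d\<close> the empty \<open>B\<close> is already large enough. The induction starts in dimension
  \<open>0\<close>, where every single vertex fills the (-1)-cycle consisting of the empty simplex.
\<close>

section \<open>Boundary, link and deletion\<close>

text \<open>Recording the added vertex instead of the larger simplex makes \<open>bd\<close>
  independent of any dimension or ambient vertex set.\<close>

definition cofaces :: "'a set set \<Rightarrow> 'a set \<Rightarrow> 'a set" where
  "cofaces X \<tau> = {w. w \<notin> \<tau> \<and> insert w \<tau> \<in> X}"

definition bd :: "'a set set \<Rightarrow> 'a set set" where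
  "bd X = {\<tau>. odd (card (cofaces X \<tau>))}"

definition link :: "'a \<Rightarrow> 'a set set \<Rightarrow> 'a set set" where
  "link v X = {\<tau>. v \<notin> \<tau> \<and> insert v \<tau> \<in> X}"

definition deletion :: "'a \<Rightarrow> 'a set set \<Rightarrow> 'a set set" where
  "deletion v X = {\<sigma> \<in> X. v \<notin> \<sigma>}"

definition ksubsets :: "'a set \<Rightarrow> nat \<Rightarrow> 'a set set" where
  "ksubsets V k = {\<sigma>. \<sigma> \<subseteq> V \<and> card \<sigma> = k}"

lemma finite_ksubsets: "finite V \<Longrightarrow> finite (ksubsets V k)"
  by (rule finite_subset[of _ "Pow V"]) (auto simp: ksubsets_def)

lemma finite_cofaces:
  assumes "finite V" "X \<subseteq> Pow V"
  shows "finite (cofaces X \<tau>)"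
  by (rule finite_subset[OF _ assms(1)]) (use assms(2) in \<open>auto simp: cofaces_def\<close>)

lemma bd_empty [simp]: "bd {} = {}"
  by (simp add: bd_def cofaces_def)

lemma bd_cofaces_ne: "\<tau> \<in> bd X \<Longrightarrow> \<exists>w. w \<notin> \<tau> \<and> insert w \<tau> \<in> X"
proof -
  assume "\<tau> \<in> bd X"
  then have "cofaces X \<tau> \<noteq> {}" by (auto simp: bd_def)
  then show ?thesis by (auto simp: cofaces_def)
qed

text \<open>Linearity over the two-element field: the cofaces common to \<open>X\<close> and
  \<open>Y\<close> are counted twice, which parity ignores. The finite \<open>V\<close> keeps
  \<open>card\<close> meaningful.\<close>

lemma bd_sym_diff:
  assumes "finite V" "X \<subseteq> Pow V" "Y \<subseteq> Pow V"
  shows "bd (sym_diff X Y) = sym_diff (bd X) (bd Y)"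
proof -
  have "odd (card (cofaces (sym_diff X Y) \<tau>)) \<longleftrightarrow>
        odd (card (cofaces X \<tau>)) \<noteq> odd (card (cofaces Y \<tau>))" for \<tau>
  proof -
    let ?x = "cofaces X \<tau>" and ?y = "cofaces Y \<tau>"
    have fin: "finite ?x" "finite ?y" using assms by (blast intro: finite_cofaces)+
    have eq: "cofaces (sym_diff X Y) \<tau> = (?x - ?y) \<union> (?y - ?x)" by (auto simp: cofaces_def)
    have "card (cofaces (sym_diff X Y) \<tau>) = card (?x - ?y) + card (?y - ?x)"
      unfolding eq using fin by (intro card_Un_disjoint) auto
    moreover have "card ?x = card (?x - ?y) + card (?x \<inter> ?y)"
      using card_Un_disjoint[of "?x - ?y" "?x \<inter> ?y"] fin by (simp add: Un_Diff_Int Int_commute) auto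
    moreover have "card ?y = card (?y - ?x) + card (?x \<inter> ?y)"
      using card_Un_disjoint[of "?y - ?x" "?x \<inter> ?y"] fin
      by (metis Diff_disjoint Int_Diff_disjoint Int_commute Un_Diff_Int finite_Diff finite_Int)
    ultimately show ?thesis by simp blast
  qed
  then show ?thesis by (auto simp: bd_def)
qed

text \<open>Besides the vertices extending \<tau> within the deletion, only \<open>v\<close> itself
  can be a coface, and it is one exactly when \<tau> lies in the link.\<close>

lemma mem_bd_avoiding:
  assumes "finite V" "X \<subseteq> Pow V" "v \<notin> \<tau>"
  shows "\<tau> \<in> bd X \<longleftrightarrow> (\<tau> \<in> link v X) \<noteq> (\<tau> \<in> bd (deletion v X))"
proof -
  have fin: "finite (cofaces (deletion v X) \<tau>)"
    using assms by (intro finite_cofaces) (auto simp: deletion_def)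
  have v: "v \<notin> cofaces (deletion v X) \<tau>" by (auto simp: cofaces_def deletion_def)
  have "cofaces X \<tau> = (if \<tau> \<in> link v X then insert v (cofaces (deletion v X) \<tau>)
                       else cofaces (deletion v X) \<tau>)"
    using assms(3) by (auto simp: cofaces_def deletion_def link_def)
  then show ?thesis using fin v by (simp add: bd_def)
qed

lemma mem_bd_insert:
  assumes "v \<notin> \<tau>"
  shows "insert v \<tau> \<in> bd X \<longleftrightarrow> \<tau> \<in> bd (link v X)"
proof -
  have "cofaces X (insert v \<tau>) = cofaces (link v X) \<tau>"
    using assms by (auto simp: cofaces_def link_def insert_commute)
  then show ?thesis by (simp add: bd_def)
qed

text \<open>A vertex completes \<open>insert v \<tau>\<close> in \<open>X\<close> iff it completes
  \<tau> in the link. In particular, links of cycles are cycles.\<close>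

lemma link_bd: "link v (bd X) = bd (link v X)"
proof -
  have "v \<notin> \<tau>" if "\<tau> \<in> bd (link v X)" for \<tau>
    using bd_cofaces_ne[OF that] by (auto simp: link_def)
  then show ?thesis using mem_bd_insert[of v] by (auto simp: link_def)
qed

text \<open>For a cycle the left side is empty, so the deletion has the link as its
  boundary.\<close>

lemma deletion_bd:
  assumes "finite V" "X \<subseteq> Pow V"
  shows "deletion v (bd X) = sym_diff (link v X) (bd (deletion v X))"
proof -
  have "v \<notin> \<tau>" if "\<tau> \<in> bd (deletion v X)" for \<tau>
    using bd_cofaces_ne[OF that] by (auto simp: deletion_def)
  then show ?thesis using mem_bd_avoiding[OF assms, of v]
    by (auto simp: deletion_def link_def)
qed

lemma link_deletion_eqI:
  assumes "link v X = link v Y" "deletion v X = deletion v Y"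
  shows "X = Y"
proof -
  have sub: "X' \<subseteq> Y'" if "link v X' = link v Y'" "deletion v X' = deletion v Y'" for X' Y'
  proof
    fix \<sigma> assume \<sigma>: "\<sigma> \<in> X'"
    show "\<sigma> \<in> Y'"
    proof (cases "v \<in> \<sigma>")
      case True
      then have "\<sigma> - {v} \<in> link v X'" using \<sigma> by (simp add: link_def insert_absorb)
      then have "\<sigma> - {v} \<in> link v Y'" using that by simp
      then show ?thesis using True by (simp add: link_def insert_absorb)
    next
      case False
      then have "\<sigma> \<in> deletion v X'" using \<sigma> by (simp add: deletion_def)
      then have "\<sigma> \<in> deletion v Y'" using that by simp
      then show ?thesis by (simp add: deletion_def)
    qed
  qed
  show ?thesis using sub assms by (metis subset_antisym)
qed

lemma link_cone_union:
  assumes "\<forall>\<sigma>\<in>A \<union> B. v \<notin> \<sigma>"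
  shows "link v (insert v ` A \<union> B) = A"
proof -
  have "insert v \<tau> = insert v \<sigma> \<longleftrightarrow> \<tau> = \<sigma>" if "v \<notin> \<tau>" "\<sigma> \<in> A" for \<tau> \<sigma>
    using that assms by (intro insert_ident) auto
  then show ?thesis using assms by (auto simp: link_def)
qed

lemma deletion_cone_union:
  assumes "\<forall>\<sigma>\<in>A \<union> B. v \<notin> \<sigma>"
  shows "deletion v (insert v ` A \<union> B) = B"
  using assms by (auto simp: deletion_def)

section \<open>Collapses\<close>

text \<open>Only the faces of top dimension are recorded; the lower ones never obstruct a collapse.\<close>

inductive collapses :: "'a set set \<Rightarrow> bool" where
  collapses_empty: "collapses {}"
| collapses_step: "cofaces F \<tau> = {a} \<Longrightarrow> collapses (F - {insert a \<tau>}) \<Longrightarrow> collapses F"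

text \<open>A simplex removed through a free face \<tau> cannot lie in a cycle, since \<tau> would
  be covered exactly once there. Hence a cycle survives every step, down to the empty set.\<close>

lemma collapses_acyclic:
  assumes "collapses F" "X \<subseteq> F" "bd X = {}"
  shows "X = {}"
  using assms
proof (induction arbitrary: X rule: collapses.induct)
  case (collapses_step F \<tau> a)
  have "insert a \<tau> \<notin> X"
  proof
    assume "insert a \<tau> \<in> X"
    then have "cofaces X \<tau> = {a}"
      using collapses_step.hyps(1) collapses_step.prems(1) by (auto simp: cofaces_def)
    then have "\<tau> \<in> bd X" by (simp add: bd_def)
    then show False using collapses_step.prems by simp
  qed
  then show ?case using collapses_step by blast
qed simp

text \<open>A free face \<tau> of \<open>A\<close> yields the free face
  \<open>insert v \<tau>\<close> of the union, because \<open>B\<close> has no simplex through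
  \<open>v\<close>. Once the cone is used up, the collapse of \<open>B\<close> takes over.\<close>

lemma collapses_cone_union:
  assumes "collapses A" "collapses B" "\<forall>\<sigma>\<in>A \<union> B. v \<notin> \<sigma>"
  shows "collapses (insert v ` A \<union> B)"
  using assms
proof (induction rule: collapses.induct)
  case (collapses_step A \<tau> a)
  let ?F = "insert v ` A \<union> B"
  have a: "a \<notin> \<tau>" "insert a \<tau> \<in> A"
    using collapses_step.hyps(1) by (auto simp: cofaces_def)
  have v: "v \<notin> insert a \<tau>" using a collapses_step.prems by blast
  have "cofaces ?F (insert v \<tau>) = cofaces (link v ?F) \<tau>"
    using v by (auto simp: cofaces_def link_def insert_commute)
  also have "\<dots> = {a}"
    using link_cone_union collapses_step by metis
  finally have 1: "cofaces ?F (insert v \<tau>) = {a}" .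
  have "inj_on (insert v) A" using collapses_step.prems by (auto intro!: inj_onI)
  then have "insert v ` (A - {insert a \<tau>}) = insert v ` A - {insert v (insert a \<tau>)}"
    using a by (subst inj_on_image_set_diff[of _ A]) auto
  moreover have "insert v (insert a \<tau>) \<notin> B" using collapses_step.prems by blast
  ultimately have "insert v ` (A - {insert a \<tau>}) \<union> B = ?F - {insert a (insert v \<tau>)}"
    by (auto simp: insert_commute)
  moreover have "collapses (insert v ` (A - {insert a \<tau>}) \<union> B)"
    using collapses_step by blast
  ultimately show ?case using 1 collapses.collapses_step by metis
qed simp

section \<open>Large fillings\<close>

text \<open>The binomial coefficient with lower index \<open>k - 2\<close> that bounds the shortfall
  in size; the case split replaces a negative index, which natural subtraction would
  truncate.\<close>

definition defect :: "nat \<Rightarrow> nat \<Rightarrow> nat" where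
  "defect m k = (if k < 2 then 0 else m choose (k - 2))"

lemma defect_Suc: "defect (Suc m) (Suc k) = defect m k + defect m (Suc k)"
proof -
  consider "k = 0" | "k = 1" | j where "k = Suc (Suc j)"
    by (metis One_nat_def not0_implies_Suc)
  then show ?thesis by cases (auto simp: defect_def)
qed

text \<open>Unimodality of binomial coefficients: the hypothesis says
  \<open>m - k \<le> k - 2\<close>, so after reflecting \<open>k\<close> to \<open>m - k\<close>
  either both indices lie in the rising half, or \<open>k - 2\<close> and \<open>k\<close> lie in
  the falling half.\<close>

lemma choose_le_defect:
  assumes "m + 2 \<le> 2 * k"
  shows "m choose k \<le> defect m k"
proof (cases "k < 2 \<or> m < k")
  case True
  then show ?thesis using assms by (auto simp: defect_def less_2_cases_iff binomial_eq_0)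
next
  case False
  then have sym: "m choose k = m choose (m - k)" by (intro binomial_symmetric) simp
  have "m choose (m - k) \<le> m choose (k - 2)"
  proof (cases "2 * (k - 2) \<le> m")
    case True
    then show ?thesis
    proof (cases "m + 2 = 2 * k")
      case True
      then have "m - k = k - 2" by arith
      then show ?thesis by simp
    next
      case neq: False
      show ?thesis using False True assms by (intro binomial_mono) auto
    qed
  next
    case small: False
    have "m choose k \<le> m choose (k - 2)"
      using small False by (intro binomial_antimono) auto
    then show ?thesis using sym by simp
  qed
  then show ?thesis using sym False by (simp add: defect_def)
qed

text \<open>Here \<open>k\<close> is the dimension of the filling, whose simplices have
  \<open>Suc k\<close> vertices. The size bound is additive to avoid truncated subtraction.\<close>

definition fillings :: "'a set \<Rightarrow> nat \<Rightarrow> 'a set set \<Rightarrow> 'a set set set" where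
  "fillings V k Z = {F. F \<subseteq> ksubsets V (Suc k) \<and> collapses F \<and> bd F = Z \<and>
     (card V - 1) choose k \<le> card F + defect (card V - 1) k}"

lemma finite_fillings: "finite V \<Longrightarrow> finite (fillings V k Z)"
  by (rule finite_subset[of _ "Pow (ksubsets V (Suc k))"])
     (auto simp: fillings_def finite_ksubsets)

lemma empty_mem_fillings:
  assumes "card V \<ge> 1" "card V + 1 \<le> 2 * k"
  shows "{} \<in> fillings V k {}"
  using choose_le_defect[of "card V - 1" k] assms
  by (auto simp: fillings_def intro: collapses_empty)

lemma singleton_mem_fillings:
  assumes "x \<in> V"
  shows "{{x}} \<in> fillings V 0 {{}}"
proof -
  have cof: "cofaces {{x}} \<tau> = (if \<tau> = {} then {x} else {})" for \<tau>
    by (auto simp: cofaces_def)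
  then have "bd {{x}} = {{}}" by (auto simp: bd_def split: if_splits)
  moreover have "collapses {{x}}"
    by (rule collapses_step[of _ "{}" x]) (use cof in \<open>auto intro: collapses_empty\<close>)
  ultimately show ?thesis using assms by (auto simp: fillings_def ksubsets_def)
qed

text \<open>The link part of the new boundary is \<open>bd A\<close>, and its deletion part is
  \<open>A + bd B\<close>, where the two copies of \<open>A\<close> cancel. Pascal's rule holds for
  the binomial coefficient and for \<open>defect\<close> alike, so the bounds for \<open>A\<close>
  and \<open>B\<close> add up.\<close>

lemma cone_union_mem_fillings:
  assumes V: "finite V" "v \<in> V" "V - {v} \<noteq> {}"
    and Z: "Z \<subseteq> Pow V"
    and A: "A \<in> fillings (V - {v}) k (link v Z)"
    and B: "B \<in> fillings (V - {v}) (Suc k) (sym_diff A (deletion v Z))"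
  shows "insert v ` A \<union> B \<in> fillings V (Suc k) Z"
proof -
  let ?F = "insert v ` A \<union> B" and ?m = "card (V - {v}) - 1"
  have sub: "A \<subseteq> ksubsets (V - {v}) (Suc k)" "B \<subseteq> ksubsets (V - {v}) (Suc (Suc k))"
    using A B by (auto simp: fillings_def)
  then have fin: "finite A" "finite B"
    using V by (meson finite_Diff finite_ksubsets finite_subset)+
  have v: "\<forall>\<sigma>\<in>A \<union> B. v \<notin> \<sigma>" using sub by (auto simp: ksubsets_def)
  have "card (insert v \<sigma>) = Suc (card \<sigma>)" if "\<sigma> \<in> A" for \<sigma>
  proof -
    have "finite \<sigma>" using sub that V by (auto simp: ksubsets_def intro: finite_subset)
    then show ?thesis using v that by simp
  qed
  then have F: "?F \<subseteq> ksubsets V (Suc (Suc k))"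
    using sub V by (fastforce simp: ksubsets_def)
  then have FP: "?F \<subseteq> Pow V" by (auto simp: ksubsets_def)
  have bdF: "bd ?F = Z"
  proof (rule link_deletion_eqI)
    show "link v (bd ?F) = link v Z"
      using A link_cone_union[OF v] by (simp add: link_bd fillings_def)
    show "deletion v (bd ?F) = deletion v Z"
      using B link_cone_union[OF v] deletion_cone_union[OF v]
      by (auto simp: deletion_bd[OF V(1) FP] fillings_def)
  qed
  have "card ?F = card (insert v ` A) + card B"
    using fin v by (intro card_Un_disjoint) auto
  moreover have "card (insert v ` A) = card A"
    using v by (intro card_image) (auto intro!: inj_onI)
  ultimately have cF: "card ?F = card A + card B" by simp
  \<comment> \<open>Nonemptiness keeps \<open>card (V - {v}) - 1\<close> from being truncated, as
    Pascal's rule requires.\<close>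
  have "card (V - {v}) > 0" using V by (subst card_gt_0_iff) simp
  then have m: "card V - 1 = Suc ?m" using V by simp
  have "(card V - 1) choose Suc k \<le> card ?F + defect (card V - 1) (Suc k)"
    unfolding m cF defect_Suc using A B by (auto simp: fillings_def)
  moreover have "collapses ?F"
    using A B v by (intro collapses_cone_union) (auto simp: fillings_def)
  ultimately show ?thesis using F bdF by (simp add: fillings_def)
qed

text \<open>Each admissible \<open>A\<close> gives its own filling of \<open>Z\<close>. At most one
  \<open>A\<close> is excluded and \<open>V\<close> has one more vertex than \<open>V - {v}\<close>;
  together this costs the 2 by which \<open>2 * Suc k\<close> exceeds \<open>2 * k\<close>.\<close>

lemma fillings_step:
  assumes V: "finite V" "v \<in> V" "V - {v} \<noteq> {}"
    and Z: "Z \<subseteq> ksubsets V (Suc k)" "bd Z = {}"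
    and A: "fillings (V - {v}) k (link v Z) \<noteq> {}"
      "card (V - {v}) \<le> card (fillings (V - {v}) k (link v Z)) + 2 * k"
    and B: "\<And>Y. Y \<subseteq> ksubsets (V - {v}) (Suc k) \<Longrightarrow> bd Y = {} \<Longrightarrow> Y \<noteq> {} \<Longrightarrow>
      fillings (V - {v}) (Suc k) Y \<noteq> {}"
  shows "fillings V (Suc k) Z \<noteq> {} \<and> card V \<le> card (fillings V (Suc k) Z) + 2 * Suc k"
proof -
  let ?W = "V - {v}" and ?Z' = "deletion v Z"
  have finA: "finite (fillings ?W k (link v Z))" using V by (simp add: finite_fillings)
  have cW: "card V = Suc (card ?W)" using V by (metis card.remove)
  have ZP: "Z \<subseteq> Pow V" and Z': "?Z' \<subseteq> ksubsets ?W (Suc k)"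
    using Z by (auto simp: ksubsets_def deletion_def)
  have bdZ': "bd ?Z' = link v Z"
    using deletion_bd[OF V(1) ZP, of v] Z(2) by (auto simp: deletion_def)
  \<comment> \<open>Below the threshold the counting claim is trivial and \<open>A = Z'\<close> may
    stay, completed by the empty \<open>B\<close>; above it, \<open>Z'\<close> has to go.\<close>
  define good where "good = (if card V \<le> 2 * Suc k then fillings ?W k (link v Z)
                             else fillings ?W k (link v Z) - {?Z'})"
  have good_sub: "good \<subseteq> fillings ?W k (link v Z)" by (auto simp: good_def)
  have card_good: "card V \<le> card good + 2 * Suc k"
  proof (cases "card V \<le> 2 * Suc k")
    case False
    then have "card (fillings ?W k (link v Z)) - 1 \<le> card good"
      using diff_card_le_card_Diff[of "{?Z'}" "fillings ?W k (link v Z)"] by (simp add: good_def)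
    then show ?thesis using A(2) cW by simp
  qed simp
  have good_ne: "good \<noteq> {}"
  proof (cases "card V \<le> 2 * Suc k")
    case True
    then show ?thesis using A(1) by (simp add: good_def)
  next
    case False
    then show ?thesis using card_good by auto
  qed
  have "\<exists>B. B \<in> fillings ?W (Suc k) (sym_diff A ?Z')" if "A \<in> good" for A
  proof (cases "A = ?Z'")
    case True
    then have "card V \<le> 2 * Suc k" using that by (auto simp: good_def split: if_splits)
    moreover have "card ?W > 0" using V by (subst card_gt_0_iff) simp
    ultimately have "{} \<in> fillings ?W (Suc k) {}" using cW by (intro empty_mem_fillings) auto
    then show ?thesis using True by auto
  next
    case False
    have A: "A \<subseteq> ksubsets ?W (Suc k)" "bd A = link v Z"
      using that good_sub by (auto simp: fillings_def)
    \<comment> \<open>Both summands have boundary \<open>link v Z\<close>, so their sum is a cycle,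
      nonempty because they differ.\<close>
    have "bd (sym_diff A ?Z') = sym_diff (bd A) (bd ?Z')"
      using A Z' V by (intro bd_sym_diff[of ?W]) (auto simp: ksubsets_def)
    then have "bd (sym_diff A ?Z') = {}" using A bdZ' by simp
    then have "fillings ?W (Suc k) (sym_diff A ?Z') \<noteq> {}"
      using A Z' False by (intro B) auto
    then show ?thesis by blast
  qed
  then obtain \<beta> where \<beta>: "\<And>A. A \<in> good \<Longrightarrow> \<beta> A \<in> fillings ?W (Suc k) (sym_diff A ?Z')"
    by metis
  define F where "F A = insert v ` A \<union> \<beta> A" for A
  have F_mem: "F ` good \<subseteq> fillings V (Suc k) Z"
    unfolding F_def using cone_union_mem_fillings[OF V ZP] good_sub \<beta> by blast
  \<comment> \<open>The link at \<open>v\<close> recovers \<open>A\<close>, so distinct choices give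
    distinct fillings.\<close>
  have "link v (F A) = A" if "A \<in> good" for A
    unfolding F_def
  proof (rule link_cone_union)
    have "A \<subseteq> ksubsets ?W (Suc k)" "\<beta> A \<subseteq> ksubsets ?W (Suc (Suc k))"
      using that good_sub \<beta>[OF that] by (auto simp: fillings_def)
    then show "\<forall>\<sigma>\<in>A \<union> \<beta> A. v \<notin> \<sigma>" by (auto simp: ksubsets_def)
  qed
  then have "inj_on F good" by (metis inj_onI)
  then have "card good \<le> card (fillings V (Suc k) Z)"
    using F_mem V by (intro card_inj_on_le) (auto simp: finite_fillings)
  then show ?thesis using F_mem good_ne card_good by auto
qed

text \<open>The face \<open>\<sigma> - {v}\<close> must have a second coface. This guarantees that a
  vertex remains after deleting \<open>v\<close>.\<close>

lemma nonempty_cycle_two_vertices: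
  assumes "bd Z = {}" "\<sigma> \<in> Z" "v \<in> \<sigma>"
  shows "\<exists>\<sigma>'\<in>Z. \<exists>w\<in>\<sigma>'. w \<noteq> v"
proof -
  have "v \<in> cofaces Z (\<sigma> - {v})" using assms by (simp add: cofaces_def insert_absorb)
  moreover have "cofaces Z (\<sigma> - {v}) \<noteq> {v}"
  proof
    assume "cofaces Z (\<sigma> - {v}) = {v}"
    then have "\<sigma> - {v} \<in> bd Z" by (simp add: bd_def)
    then show False using assms by simp
  qed
  ultimately obtain w where "w \<in> cofaces Z (\<sigma> - {v})" "w \<noteq> v" by blast
  then show ?thesis unfolding cofaces_def by blast
qed

text \<open>The count is carried along because existence depends on it: when one \<open>A\<close> is
  excluded, another must be left. Nonemptiness is stated separately since the count says nothing for
  \<open>card V \<le> 2 * k\<close>. Both \<open>k\<close> and \<open>Z\<close> vary in the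
  induction, as \<open>A\<close> and \<open>B\<close> have different dimensions.\<close>

theorem card_fillings:
  assumes "finite V" "V \<noteq> {}" "Z \<subseteq> ksubsets V k" "bd Z = {}" "Z \<noteq> {}"
  shows "fillings V k Z \<noteq> {} \<and> card V \<le> card (fillings V k Z) + 2 * k"
  using assms
proof (induction "card V" arbitrary: V k Z rule: less_induct)
  case less
  show ?case
  proof (cases k)
    case 0
    have "\<sigma> = {}" if "\<sigma> \<in> Z" for \<sigma>
      using that less.prems 0 finite_subset[of \<sigma> V] by (auto simp: ksubsets_def)
    then have Z: "Z = {{}}" using less.prems(5) by blast
    let ?S = "(\<lambda>x. {{x}}) ` V"
    have S: "?S \<subseteq> fillings V k Z" using singleton_mem_fillings 0 Z by fast
    have "card ?S = card V" by (intro card_image inj_onI) simp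
    then have "card V \<le> card (fillings V k Z)"
      using card_mono[OF finite_fillings S] less.prems(1) by simp
    then show ?thesis using S less.prems(2) by auto
  next
    case (Suc j)
    obtain \<sigma> where \<sigma>: "\<sigma> \<in> Z" using less.prems(5) by blast
    then have "card \<sigma> = Suc j" using less.prems(3) Suc by (auto simp: ksubsets_def)
    then obtain v where v: "v \<in> \<sigma>" by fastforce
    have vV: "v \<in> V" using v \<sigma> less.prems(3) by (auto simp: ksubsets_def)
    have ne: "V - {v} \<noteq> {}"
      using nonempty_cycle_two_vertices[OF less.prems(4) \<sigma> v] less.prems(3)
      by (fastforce simp: ksubsets_def)
    have lt: "card (V - {v}) < card V" using vV less.prems(1) by (rule card_Diff1_less[rotated])
    have L: "link v Z \<subseteq> ksubsets (V - {v}) j"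
    proof
      fix \<tau> assume "\<tau> \<in> link v Z"
      then have \<tau>: "v \<notin> \<tau>" "insert v \<tau> \<in> ksubsets V (Suc j)"
        using less.prems(3) Suc by (auto simp: link_def)
      then have "finite \<tau>" using less.prems(1) by (auto simp: ksubsets_def intro: finite_subset)
      then show "\<tau> \<in> ksubsets (V - {v}) j" using \<tau> by (auto simp: ksubsets_def)
    qed
    have "\<sigma> - {v} \<in> link v Z" using v \<sigma> by (simp add: link_def insert_absorb)
    moreover have "bd (link v Z) = {}"
      using link_bd[of v Z] less.prems(4) by (simp add: link_def)
    ultimately have "fillings (V - {v}) j (link v Z) \<noteq> {} \<and>
        card (V - {v}) \<le> card (fillings (V - {v}) j (link v Z)) + 2 * j"
      using less.hyps[OF lt _ ne L] less.prems(1) by blast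
    moreover have "fillings (V - {v}) (Suc j) Y \<noteq> {}"
      if "Y \<subseteq> ksubsets (V - {v}) (Suc j)" "bd Y = {}" "Y \<noteq> {}" for Y
      using less.hyps[OF lt _ ne that] less.prems(1) by blast
    ultimately show ?thesis
      unfolding Suc using less.prems Suc vV ne by (intro fillings_step[where v = v]) auto
  qed
qed

section \<open>Translation to integer dimensions\<close>

lemma simplices_eq_ksubsets: "simplices n (int k - 1) = ksubsets {1..n} k"
  by (auto simp: simplices_def ksubsets_def)

text \<open>A superset with one more element is determined by the vertex it adds.\<close>

lemma card_supersets_eq_card_cofaces:
  assumes "finite \<tau>" "\<forall>\<sigma>\<in>X. card \<sigma> = Suc (card \<tau>)"
  shows "{\<sigma> \<in> X. \<tau> \<subseteq> \<sigma>} = (\<lambda>w. insert w \<tau>) ` cofaces X \<tau>"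
    and "card {\<sigma> \<in> X. \<tau> \<subseteq> \<sigma>} = card (cofaces X \<tau>)"
proof -
  show eq: "{\<sigma> \<in> X. \<tau> \<subseteq> \<sigma>} = (\<lambda>w. insert w \<tau>) ` cofaces X \<tau>"
  proof
    show "{\<sigma> \<in> X. \<tau> \<subseteq> \<sigma>} \<subseteq> (\<lambda>w. insert w \<tau>) ` cofaces X \<tau>"
    proof
      fix \<sigma> assume "\<sigma> \<in> {\<sigma> \<in> X. \<tau> \<subseteq> \<sigma>}"
      then have \<sigma>: "\<sigma> \<in> X" "\<tau> \<subseteq> \<sigma>" by auto
      then have "card (\<sigma> - \<tau>) = 1" using assms by (simp add: card_Diff_subset)
      then obtain w where "\<sigma> - \<tau> = {w}" by (auto simp: card_1_singleton_iff)
      then have "\<sigma> = insert w \<tau>" "w \<notin> \<tau>" using \<sigma> by auto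
      then show "\<sigma> \<in> (\<lambda>w. insert w \<tau>) ` cofaces X \<tau>" using \<sigma> by (auto simp: cofaces_def)
    qed
  qed (auto simp: cofaces_def)
  have "inj_on (\<lambda>w. insert w \<tau>) (cofaces X \<tau>)" by (auto simp: inj_on_def cofaces_def)
  then show "card {\<sigma> \<in> X. \<tau> \<subseteq> \<sigma>} = card (cofaces X \<tau>)" by (simp add: eq card_image)
qed

lemma boundary_eq_bd:
  assumes "X \<subseteq> simplices n d"
  shows "boundary n d X = bd X"
proof -
  have eq: "card {\<sigma> \<in> X. \<tau> \<subseteq> \<sigma>} = card (cofaces X \<tau>)" if "\<tau> \<in> simplices n (d - 1)" for \<tau>
  proof (rule card_supersets_eq_card_cofaces)
    show "finite \<tau>" using that by (auto simp: simplices_def intro: finite_subset)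
    show "\<forall>\<sigma>\<in>X. card \<sigma> = Suc (card \<tau>)"
    proof
      fix \<sigma> assume "\<sigma> \<in> X"
      then have "int (card \<sigma>) = d + 1" using assms by (auto simp: simplices_def)
      then show "card \<sigma> = Suc (card \<tau>)" using that by (simp add: simplices_def)
    qed
  qed
  have "\<tau> \<in> simplices n (d - 1)" if \<tau>: "\<tau> \<in> bd X" for \<tau>
  proof -
    obtain w where w: "w \<notin> \<tau>" "insert w \<tau> \<in> simplices n d"
      using bd_cofaces_ne[OF \<tau>] assms by blast
    then have "finite \<tau>" by (auto simp: simplices_def intro: finite_subset)
    then show ?thesis using w by (auto simp: simplices_def)
  qed
  then show ?thesis using eq by (auto simp: boundary_def bd_def)
qed

text \<open>Generalized to any \<open>K\<close> whose top faces form \<open>F\<close> and which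
  contains all their codimension-one faces; unlike being a generated complex, this survives each
  step.\<close>

lemma collapses_imp_elementary_collapses:
  assumes "collapses F" "K \<inter> simplices n d = F"
    and "\<forall>\<sigma>\<in>F. \<forall>\<tau>\<in>simplices n (d - 1). \<tau> \<subseteq> \<sigma> \<longrightarrow> \<tau> \<in> K"
  shows "\<exists>K'. (elementary_collapse n d)\<^sup>*\<^sup>* K K' \<and> K' \<inter> simplices n d = {}"
  using assms
proof (induction arbitrary: K rule: collapses.induct)
  case collapses_empty
  then show ?case by blast
next
  case (collapses_step F \<tau> a)
  let ?\<sigma> = "insert a \<tau>" and ?K = "K - {insert a \<tau>, \<tau>}"
  have F: "F \<subseteq> simplices n d" using collapses_step.prems(1) by blast
  have a: "a \<notin> \<tau>" "?\<sigma> \<in> F" using collapses_step.hyps(1) by (auto simp: cofaces_def)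
  then have s: "?\<sigma> \<in> simplices n d" using F by blast
  then have fin: "finite \<tau>" by (auto simp: simplices_def intro: finite_subset)
  then have \<tau>: "\<tau> \<in> simplices n (d - 1)" using s a by (auto simp: simplices_def)
  have "\<forall>\<sigma>\<in>F. card \<sigma> = Suc (card \<tau>)"
  proof
    fix \<sigma> assume "\<sigma> \<in> F"
    then have "int (card \<sigma>) = d + 1" using F by (auto simp: simplices_def)
    then show "card \<sigma> = Suc (card \<tau>)" using \<tau> by (simp add: simplices_def)
  qed
  from card_supersets_eq_card_cofaces(1)[OF fin this]
  have up: "{\<rho> \<in> F. \<tau> \<subseteq> \<rho>} = {?\<sigma>}"
    unfolding collapses_step.hyps(1) by simp
  have "\<tau> \<in> K" using collapses_step.prems(2) a \<tau> by blast
  then have step: "elementary_collapse n d K ?K"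
    unfolding elementary_collapse_def collapses_step.prems(1)
    using \<tau> up by blast
  have "\<tau> \<notin> simplices n d" using \<tau> by (auto simp: simplices_def)
  then have K1: "?K \<inter> simplices n d = F - {?\<sigma>}" using collapses_step.prems(1) by blast
  \<comment> \<open>The removed \<tau> lay under no other top face, and the removed top face has the
    wrong dimension to be a codimension-one face.\<close>
  have "?\<sigma> \<notin> simplices n (d - 1)" using s by (auto simp: simplices_def)
  then have "\<forall>\<sigma>\<in>F - {?\<sigma>}. \<forall>\<rho>\<in>simplices n (d - 1). \<rho> \<subseteq> \<sigma> \<longrightarrow> \<rho> \<in> ?K"
    using collapses_step.prems(2) up by blast
  then obtain K' where "(elementary_collapse n d)\<^sup>*\<^sup>* ?K K'" "K' \<inter> simplices n d = {}"
    using collapses_step.IH[OF K1] by blast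
  then show ?case
    using converse_rtranclp_into_rtranclp[of "elementary_collapse n d", OF step] by blast
qed

lemma collapses_imp_collapsible:
  assumes "collapses F" "F \<subseteq> simplices n d"
  shows "collapsible n d F"
  unfolding collapsible_def
proof (rule collapses_imp_elementary_collapses[OF assms(1)])
  have "\<sigma> = \<tau>" if "\<sigma> \<in> F" "\<tau> \<subseteq> \<sigma>" "\<tau> \<in> simplices n d" for \<sigma> \<tau>
  proof -
    have "\<sigma> \<in> simplices n d" using that assms(2) by blast
    then have "finite \<sigma>" "card \<tau> = card \<sigma>"
      using that(3) by (auto simp: simplices_def intro: finite_subset)
    then show ?thesis using card_subset_eq that(2) by metis
  qed
  then show "generated_complex F \<inter> simplices n d = F"
    using assms(2) unfolding generated_complex_def by blast
qed (auto simp: generated_complex_def)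

lemma collapses_imp_is_forest:
  assumes "collapses F" "F \<subseteq> simplices n d"
  shows "is_forest n d F"
proof -
  have "X = {}" if "X \<subseteq> F" "is_cycle n d X" for X
    using that boundary_eq_bd[of X n d] collapses_acyclic[OF assms(1)]
    by (simp add: is_cycle_def)
  then show ?thesis using assms(2) by (auto simp: is_forest_def)
qed

theorem theorem2:
  fixes d :: int and n :: nat and Z :: "nat set set"
  assumes "d \<ge> 1" and "n \<ge> 1"
    and "is_cycle n (d - 1) Z" and "Z \<noteq> {}"
  shows "(\<exists>F. is_forest n d F \<and> collapsible n d F \<and> boundary n d F = Z \<and>
              int (binom (n - 1) d) - int (card F) \<le> int (binom (n - 1) (d - 2)))
       \<and> int (card {F. is_forest n d F \<and> collapsible n d F \<and> boundary n d F = Z \<and>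
              int (binom (n - 1) d) - int (card F) \<le> int (binom (n - 1) (d - 2))})
           \<ge> int n - 2 * d"
    (is "(\<exists>F. ?P F) \<and> _")
proof -
  define k where "k = nat d"
  have d: "d = int k" using assms(1) by (simp add: k_def)
  have simp_d: "simplices n d = ksubsets {1..n} (Suc k)"
    using simplices_eq_ksubsets[of n "Suc k"] d by simp
  \<comment> \<open>For \<open>d = 1\<close> both conventions give 0: \<open>binom\<close> by its
    negative index, \<open>defect\<close> by its case \<open>k < 2\<close>.\<close>
  have binoms: "binom (n - 1) d = (n - 1) choose k" "binom (n - 1) (d - 2) = defect (n - 1) k"
    by (auto simp: binom_def defect_def d nat_diff_distrib')
  have Z: "Z \<subseteq> ksubsets {1..n} k" "bd Z = {}"
    using assms(3) boundary_eq_bd[of Z n "d - 1"] simplices_eq_ksubsets[of n k] d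
    by (auto simp: is_cycle_def)
  have main: "fillings {1..n} k Z \<noteq> {}" "n \<le> card (fillings {1..n} k Z) + 2 * k"
    using card_fillings[of "{1..n}" Z k] Z assms(2,4) by auto
  have P: "?P F" if "F \<in> fillings {1..n} k Z" for F
    using that collapses_imp_is_forest[of F n d] collapses_imp_collapsible[of F n d]
      boundary_eq_bd[of F n d]
    unfolding binoms by (auto simp: fillings_def simp_d)
  \<comment> \<open>Without finiteness \<open>card\<close> would default to 0 and the comparison
    with \<open>fillings\<close> would fail.\<close>
  have "finite {F. ?P F}"
    by (rule finite_subset[of _ "Pow (simplices n d)"])
       (auto simp: is_forest_def simp_d finite_ksubsets)
  then have "card (fillings {1..n} k Z) \<le> card {F. ?P F}"
    using P by (intro card_mono) auto
  then show ?thesis using main P d by (auto simp: ex_in_conv[symmetric])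
qed

end
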